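(* Let $L$ be a random variable with values in $\{0,1,2,\dots\}$ and let $(Z_n)_{n\ge 0}$ be the Galton-Watson branching process with offspring variable $L$ and $Z_0=1$. Suppose that its offspring mean $m := \mathbf{E}[L]$ satisfies $1 < m < \infty$. Let $q := \lim_{n\to\infty}\mathbf{P}[Z_n=0]$ be the extinction probability, and let $W$ be the almost sure limit of the nonnegative martingale $Z_n/m^n$. Then the following are equivalent: (i) $\mathbf{P}[W=0]=q$; (ii) $\mathbf{E}[W]=1$; (iii) $\mathbf{E}[L\log^+ L]<\infty$.
   Context: Galton-Watson process: $Z_0=1$ and $Z_{n+1}=\sum_{i=1}^{Z_n} L_{n,i}$, where the $L_{n,i}$ are i.i.d. copies of $L$ (each particle in generation $n$ independently has a number of children distributed as $L$). Notation: $\log^+ x := \max(\log x, 0)$ for $x>0$, and $0\log^+ 0 := 0$. *)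

theory Defs
  imports "HOL-Probability.Probability"
begin

(* The argument xi n i is the number of children of the i-th particle of
   generation n; particles of a generation are numbered from 0. *)
fun galton_watson :: "(nat \<Rightarrow> nat \<Rightarrow> 'a \<Rightarrow> nat) \<Rightarrow> nat \<Rightarrow> 'a \<Rightarrow> nat" where
  "galton_watson \<xi> 0 \<omega> = 1"
| "galton_watson \<xi> (Suc n) \<omega> = (\<Sum>i<galton_watson \<xi> n \<omega>. \<xi> n i \<omega>)"

definition iid_copies ::
  "'a measure \<Rightarrow> (nat \<Rightarrow> nat \<Rightarrow> 'a \<Rightarrow> nat) \<Rightarrow> 'b measure \<Rightarrow> ('b \<Rightarrow> nat) \<Rightarrow> bool" where
  "iid_copies M \<xi> N L \<longleftrightarrow>
     prob_space.indep_vars M (\<lambda>_. count_space UNIV) (\<lambda>(n, i). \<xi> n i) UNIV \<and>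
     (\<forall>n i. distr M (count_space UNIV) (\<xi> n i) = distr N (count_space UNIV) L)"

definition extinction_prob :: "'a measure \<Rightarrow> (nat \<Rightarrow> 'a \<Rightarrow> nat) \<Rightarrow> real" where
  "extinction_prob M Z = lim (\<lambda>n. measure M {\<omega> \<in> space M. Z n \<omega> = 0})"

(* Only used in products x * log_plus x with x >= 0, where the value at 0 does not matter. *)
definition log_plus :: "real \<Rightarrow> real" where
  "log_plus x = max (ln x) 0"

end

theory Submission
  imports Defs "HOL-Real_Asymp.Real_Asymp"
begin

text \<open>
  Let \<open>f\<close> be the generating function of \<open>L\<close> and write \<open>1 - f (1 - t) = t * (m - D t)\<close>, where \<open>D\<close> is strictly
  increasing and vanishes at \<open>0\<close>. A layer count of the scales \<open>m^-k\<close> against \<open>1 / L\<close> shows that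
  \<open>E [L * log_plus L]\<close> is finite iff \<open>\<Sum>k. D (c / m^k)\<close> converges, for any \<open>0 < c \<le> 1\<close>.
  For \<open>\<psi> u = E [1 - exp (- u W)]\<close> the branching property gives \<open>\<psi> (m u) = 1 - f (1 - \<psi> u)\<close>, so
  \<open>h u = \<psi> u / u\<close>, which tends to \<open>E [W] \<le> 1\<close> as \<open>u\<close> decreases to \<open>0\<close>, satisfies
  \<open>h (m u) = h u * (1 - D (\<psi> u) / m)\<close>. If \<open>W\<close> does not vanish, then \<open>h\<close> is bounded below near \<open>0\<close>,
  hence \<open>\<psi> u \<ge> c u\<close>, and telescoping bounds \<open>\<Sum>k. D (c / m^k)\<close>. Conversely, iterating the same
  recursion for \<open>Z n / m^n\<close> and using \<open>\<psi> u \<le> u\<close> gives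
  \<open>h u \<ge> 1 - (1 / m) * (\<Sum>k\<ge>1. D (u / m^k))\<close>, which tends to \<open>1\<close> if the series converges.
  Finally, \<open>P [W = 0] = 1 - \<psi> (\<infinity>)\<close> is a fixed point of \<open>f\<close>, hence either \<open>q\<close> or \<open>1\<close>.
\<close>

subsection \<open>The defect of a power\<close>

text \<open>If each of \<open>l\<close> items is marked independently with probability
  \<open>t\<close>, then \<open>t * defect l t\<close> is the expected number of marked items minus
  the probability that some item is marked. As a sum of terms increasing in \<open>t\<close> it can
  be estimated term by term.\<close>

definition defect :: "nat \<Rightarrow> real \<Rightarrow> real" where
  "defect l t = (\<Sum>i<l. 1 - (1 - t) ^ i)"

lemma one_minus_power_defect: "1 - (1 - t) ^ l = t * (real l - defect l t)"
  using one_diff_power_eq[of "1 - t" l] by (simp add: defect_def sum_subtractf)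

lemma defect_nonneg: "0 \<le> t \<Longrightarrow> t \<le> 1 \<Longrightarrow> 0 \<le> defect l t"
  by (auto simp: defect_def intro!: sum_nonneg power_le_one)

lemma defect_le: "t \<le> 1 \<Longrightarrow> defect l t \<le> real l"
  using sum_bounded_above[of "{..<l}" "\<lambda>i. 1 - (1 - t) ^ i" 1] by (simp add: defect_def)

lemma defect_mono: "s \<le> t \<Longrightarrow> t \<le> 1 \<Longrightarrow> defect l s \<le> defect l t"
  unfolding defect_def by (intro sum_mono diff_left_mono power_mono) auto

text \<open>The summand with index 1 equals \<open>t\<close>, and it is present as soon as
  \<open>2 \<le> l\<close>.\<close>

lemma defect_strict_mono:
  assumes "s < t" "t \<le> 1" "2 \<le> l"
  shows "defect l s < defect l t"
  unfolding defect_def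
proof (rule sum_strict_mono_ex1)
  show "\<forall>i\<in>{..<l}. 1 - (1 - s) ^ i \<le> 1 - (1 - t) ^ i"
    using assms by (intro ballI diff_left_mono power_mono) auto
  show "\<exists>i\<in>{..<l}. 1 - (1 - s) ^ i < 1 - (1 - t) ^ i"
    using assms by (intro bexI[of _ 1]) auto
qed auto

text \<open>By Bernoulli's inequality each of the \<open>l\<close> summands is at most
  \<open>l * t\<close>. The bound is useful for \<open>t\<close> well below
  \<open>1 / l\<close>.\<close>

lemma defect_upper:
  assumes "0 \<le> t" "t \<le> 1"
  shows "defect l t \<le> real l * (real l * t)"
proof -
  have "1 - (1 - t) ^ i \<le> real l * t" if "i < l" for i
  proof -
    have "1 - real i * t \<le> (1 - t) ^ i"
      using Bernoulli_inequality[of "- t" i] assms by simp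
    moreover have "real i * t \<le> real l * t"
      using that assms by (intro mult_right_mono) auto
    ultimately show ?thesis by linarith
  qed
  then have "defect l t \<le> (\<Sum>i<l. real l * t)"
    unfolding defect_def by (intro sum_mono) auto
  then show ?thesis by simp
qed

text \<open>A complement of a power is at most 1, so
  \<open>t * (l - defect l t) \<le> 1 \<le> t * l / 2\<close>. With \<open>defect_upper\<close> this
  shows that the defect rises from near 0 to order \<open>l\<close> around \<open>t = 1 / l\<close>,
  which is what the layer counts below exploit.\<close>

lemma defect_lower:
  assumes "0 \<le> t" "t \<le> 1" "2 \<le> t * real l"
  shows "real l / 2 \<le> defect l t"
proof -
  have t: "0 < t" using assms by (cases "t = 0") auto
  have "t * (real l - defect l t) \<le> 1"
    using assms by (simp flip: one_minus_power_defect)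
  also have "1 \<le> t * (real l / 2)" using assms by simp
  finally show ?thesis using t by (simp add: mult_le_cancel_left_pos)
qed

text \<open>Split at the scale \<open>1 / l\<close>: about \<open>log m l\<close> indices lie before
  it and contribute at most \<open>l\<close> each; after it the terms decay geometrically by
  \<open>defect_upper\<close>.\<close>

lemma sum_defect_upper:
  assumes "1 < m"
  shows "(\<Sum>k<n. defect l (1 / m ^ k)) \<le>
    1 / ln m * (real l * log_plus (real l)) + (1 + m / (m - 1)) * real l"
proof (cases "l = 0")
  case True
  then show ?thesis by (simp add: defect_def)
next
  case False
  \<comment> \<open>The least exponent with \<open>l \<le> m ^ a\<close>, that is, the split
    point.\<close>
  define a where "a = nat \<lceil>log m (real l)\<rceil>"
  have m: "0 < m" "m \<noteq> 0" "m \<ge> 1" using assms by auto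
  have le1: "1 / m ^ k \<le> 1" for k using m by simp
  have "log m (real l) \<le> real a" unfolding a_def by linarith
  then have la: "real l \<le> m ^ a"
    using assms False by (simp add: log_le_iff powr_realpow)
  have aub: "real a \<le> log_plus (real l) / ln m + 1"
  proof -
    have "0 \<le> log m (real l)" using assms False by simp
    then have "real a \<le> log m (real l) + 1" unfolding a_def by linarith
    also have "log m (real l) \<le> log_plus (real l) / ln m"
      using assms by (simp add: log_def log_plus_def divide_right_mono)
    finally show ?thesis by simp
  qed
  have geo: "(\<Sum>j<n. 1 / m ^ j) \<le> m / (m - 1)"
  proof -
    have "(\<Sum>j<n. (1 / m) ^ j) \<le> (\<Sum>j. (1 / m) ^ j)"
      using assms by (intro sum_le_suminf summable_geometric) auto
    also have "\<dots> = 1 / (1 - 1 / m)" using assms by (intro suminf_geometric) auto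
    also have "\<dots> = m / (m - 1)" using assms by (simp add: field_simps)
    finally show ?thesis by (simp add: power_one_over)
  qed
  \<comment> \<open>Enlarging the range to \<open>a + n\<close> avoids distinguishing whether
    \<open>n\<close> exceeds \<open>a\<close>.\<close>
  have "(\<Sum>k<n. defect l (1 / m ^ k)) \<le> (\<Sum>k<a + n. defect l (1 / m ^ k))"
    using m by (intro sum_mono2 defect_nonneg le1) auto
  also have "\<dots> = (\<Sum>k<a. defect l (1 / m ^ k)) + (\<Sum>j<n. defect l (1 / m ^ (a + j)))"
    by (induction n) auto
  also have "\<dots> \<le> (\<Sum>k<a. real l) + (\<Sum>j<n. real l * (1 / m ^ j))"
  proof (intro add_mono sum_mono)
    show "defect l (1 / m ^ k) \<le> real l" for k by (intro defect_le le1)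
    fix j
    have "defect l (1 / m ^ (a + j)) \<le> real l * (real l * (1 / m ^ (a + j)))"
      using m by (intro defect_upper le1) auto
    also have "\<dots> \<le> real l * (m ^ a * (1 / m ^ (a + j)))"
      using la m by (intro mult_left_mono mult_right_mono) auto
    also have "\<dots> = real l * (1 / m ^ j)" using m by (simp add: power_add)
    finally show "defect l (1 / m ^ (a + j)) \<le> real l * (1 / m ^ j)" .
  qed
  also have "\<dots> = real l * (real a + (\<Sum>j<n. 1 / m ^ j))"
    by (simp add: sum_distrib_left algebra_simps)
  also have "\<dots> \<le> real l * (log_plus (real l) / ln m + 1 + m / (m - 1))"
    using aub geo by (intro mult_left_mono) auto
  finally show ?thesis by (simp add: algebra_simps)
qed

text \<open>By \<open>defect_lower\<close> every scale with \<open>c / m ^ k \<ge> 2 / l\<close>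
  contributes at least \<open>l / 2\<close>, and there are at least \<open>log m (c * l / 2)\<close>
  of them. The constants 2 and \<open>c\<close> inside the logarithm cost only a multiple of
  \<open>l\<close>.\<close>

lemma sum_defect_lower:
  assumes "1 < m" "0 < c" "c \<le> 1"
  obtains n where "real l * log_plus (real l) \<le>
    2 * ln m * (\<Sum>k<n. defect l (c / m ^ k)) + (ln 2 - ln c) * real l"
proof (cases "l = 0")
  case True
  then show ?thesis using that[of 0] by simp
next
  case False
  define y where "y = log m (c * real l / 2)"
  \<comment> \<open>The number of \<open>k\<close> with \<open>m ^ k \<le> c * l / 2\<close>; it is
    0 if \<open>y\<close> is negative, and \<open>y \<le> n\<close> holds in either case.\<close>
  define n where "n = nat (\<lfloor>y\<rfloor> + 1)"
  have "real l / 2 \<le> defect l (c / m ^ k)" if "k < n" for k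
  proof (rule defect_lower)
    have "real k \<le> y" using that unfolding n_def by linarith
    then have "m ^ k \<le> c * real l / 2"
      using assms False unfolding y_def by (simp add: le_log_iff powr_realpow)
    then show "2 \<le> c / m ^ k * real l" using assms by (simp add: field_simps)
    have "1 \<le> m ^ k" using assms by simp
    then have "c \<le> m ^ k" using assms(3) by linarith
    then show "c / m ^ k \<le> 1" using assms(1) by simp
  qed (use assms in auto)
  then have "(\<Sum>k<n. real l / 2) \<le> (\<Sum>k<n. defect l (c / m ^ k))"
    by (intro sum_mono) auto
  moreover have "y * (real l / 2) \<le> (\<Sum>k<n. real l / 2)"
  proof -
    have "y \<le> real n" unfolding n_def by linarith
    then have "y * (real l / 2) \<le> real n * (real l / 2)" by (intro mult_right_mono) auto
    then show ?thesis by simp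
  qed
  ultimately have "2 * ln m * (y * (real l / 2)) \<le> 2 * ln m * (\<Sum>k<n. defect l (c / m ^ k))"
    using assms by (intro mult_left_mono) auto
  moreover have "y = (ln c + ln (real l) - ln 2) / ln m"
    using assms False by (simp add: y_def log_def ln_mult ln_div)
  then have "2 * ln m * (y * (real l / 2)) = (ln c + ln (real l) - ln 2) * real l"
    using assms by simp
  moreover have "log_plus (real l) = ln (real l)"
    using False by (simp add: log_plus_def)
  ultimately show ?thesis by (intro that[of n]) (simp add: algebra_simps)
qed

subsection \<open>The offspring generating function\<close>

locale offspring_law = prob_space N
  for N :: "'b measure" +
  fixes L :: "'b \<Rightarrow> nat" and m :: real
  assumes measurable_L [measurable]: "L \<in> measurable N (count_space UNIV)"
    and integrable_L: "integrable N (\<lambda>x. real (L x))"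
    and m_eq: "m = (\<integral>x. real (L x) \<partial>N)"
    and m_gt_1: "1 < m"
begin

definition pgf :: "real \<Rightarrow> real" where
  "pgf s = (\<integral>x. s ^ L x \<partial>N)"

text \<open>The function \<open>D\<close> of the overview: the amount by which the slope of the
  chord of \<open>pgf\<close> over \<open>[1 - t, 1]\<close> falls short of the mean
  \<open>m\<close>.\<close>

definition mean_defect :: "real \<Rightarrow> real" where
  "mean_defect t = (\<integral>x. defect (L x) t \<partial>N)"

lemma div_power_m_bounds:
  assumes "0 \<le> c" "c \<le> 1"
  shows "0 \<le> c / m ^ n" "c / m ^ n \<le> 1"
proof -
  have "1 \<le> m ^ n" using m_gt_1 by simp
  then have "c \<le> m ^ n" using assms(2) by linarith
  then show "0 \<le> c / m ^ n" "c / m ^ n \<le> 1" using m_gt_1 assms by auto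
qed

lemma measurable_fun_L [measurable]: "(\<lambda>x. f (L x)) \<in> borel_measurable N"
  by (rule measurable_compose[OF measurable_L]) simp

lemma integrable_power_L:
  fixes s :: real
  assumes "0 \<le> s" "s \<le> 1"
  shows "integrable N (\<lambda>x. s ^ L x)"
  using assms by (intro integrable_const_bound[where B = 1]) (auto intro: power_le_one)

lemma integrable_defect:
  assumes "0 \<le> t" "t \<le> 1"
  shows "integrable N (\<lambda>x. defect (L x) t)"
  using assms
  by (intro Bochner_Integration.integrable_bound[OF integrable_L])
     (auto simp: defect_nonneg defect_le)

lemma one_minus_pgf:
  assumes "0 \<le> t" "t \<le> 1"
  shows "1 - pgf (1 - t) = t * (m - mean_defect t)"
proof -
  have "1 - pgf (1 - t) = (\<integral>x. 1 - (1 - t) ^ L x \<partial>N)"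
    using assms integrable_power_L[of "1 - t"] by (simp add: pgf_def prob_space)
  also have "\<dots> = (\<integral>x. t * (real (L x) - defect (L x) t) \<partial>N)"
    by (simp add: one_minus_power_defect)
  also have "\<dots> = t * (m - mean_defect t)"
    using assms integrable_L integrable_defect by (simp add: m_eq mean_defect_def)
  finally show ?thesis .
qed

lemma mean_defect_nonneg: "0 \<le> t \<Longrightarrow> t \<le> 1 \<Longrightarrow> 0 \<le> mean_defect t"
  by (simp add: mean_defect_def defect_nonneg)

lemma mean_defect_mono: "0 \<le> s \<Longrightarrow> s \<le> t \<Longrightarrow> t \<le> 1 \<Longrightarrow> mean_defect s \<le> mean_defect t"
  unfolding mean_defect_def by (intro integral_mono integrable_defect defect_mono) auto

text \<open>Equality would make a nonnegative integrand vanish almost surely, forcing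
  \<open>L \<le> 1\<close> almost surely and contradicting \<open>1 < m\<close>. This takes the
  place of strict convexity of \<open>pgf\<close>.\<close>

lemma mean_defect_strict_mono:
  assumes "0 \<le> s" "s < t" "t \<le> 1"
  shows "mean_defect s < mean_defect t"
proof (rule ccontr)
  have int: "integrable N (\<lambda>x. defect (L x) t - defect (L x) s)"
    using assms by (intro Bochner_Integration.integrable_diff integrable_defect) auto
  assume "\<not> mean_defect s < mean_defect t"
  then have "mean_defect t = mean_defect s"
    using mean_defect_mono[of s t] assms by simp
  then have "(\<integral>x. defect (L x) t - defect (L x) s \<partial>N) = 0"
    using assms integrable_defect by (simp add: mean_defect_def)
  then have "AE x in N. defect (L x) t - defect (L x) s = 0"
    using int assms defect_mono[of s t] by (subst (asm) integral_nonneg_eq_0_iff_AE) auto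
  then have "AE x in N. real (L x) \<le> 1"
  proof eventually_elim
    case (elim x)
    then show ?case using defect_strict_mono[of s t "L x"] assms by (cases "2 \<le> L x") auto
  qed
  then have "m \<le> (\<integral>x. 1 \<partial>N)"
    unfolding m_eq using integrable_L by (intro integral_mono_AE) auto
  then show False using m_gt_1 by (simp add: prob_space)
qed

lemma mean_defect_tendsto_0: "(\<lambda>n. mean_defect (1 / m ^ n)) \<longlonglongrightarrow> 0"
proof -
  have t: "0 \<le> 1 / m ^ n" "1 / m ^ n \<le> 1" for n using m_gt_1 by auto
  have "(\<lambda>n. \<integral>x. defect (L x) (1 / m ^ n) \<partial>N) \<longlonglongrightarrow> (\<integral>x. 0 \<partial>N)"
  proof (rule integral_dominated_convergence[where w = "\<lambda>x. real (L x)"])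
    have "(\<lambda>n. (1 / m) ^ n) \<longlonglongrightarrow> 0" using m_gt_1 by (intro LIMSEQ_realpow_zero) auto
    then have "(\<lambda>n. 1 / m ^ n) \<longlonglongrightarrow> 0" by (simp add: power_one_over)
    then have "(\<lambda>n. defect l (1 / m ^ n)) \<longlonglongrightarrow> (\<Sum>i<l. 1 - (1 - 0) ^ i)" for l
      unfolding defect_def by (intro tendsto_intros)
    then show "AE x in N. (\<lambda>n. defect (L x) (1 / m ^ n)) \<longlonglongrightarrow> 0" by simp
    show "AE x in N. norm (defect (L x) (1 / m ^ n)) \<le> real (L x)" for n
      using t by (simp add: defect_le defect_nonneg)
  qed (use integrable_L in auto)
  then show ?thesis by (simp add: mean_defect_def)
qed

section \<open>Iterates and fixed points of the generating function\<close>

lemma pgf_nonneg: "0 \<le> s \<Longrightarrow> 0 \<le> pgf s"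
  by (simp add: pgf_def)

lemma pgf_mono: "0 \<le> s \<Longrightarrow> s \<le> t \<Longrightarrow> t \<le> 1 \<Longrightarrow> pgf s \<le> pgf t"
  unfolding pgf_def by (intro integral_mono integrable_power_L power_mono) auto

lemma pgf_1 [simp]: "pgf 1 = 1"
  by (simp add: pgf_def prob_space)

lemma pgf_le_1: "0 \<le> s \<Longrightarrow> s \<le> 1 \<Longrightarrow> pgf s \<le> 1"
  using pgf_mono[of s 1] by simp

lemma pgf_funpow_bounds:
  assumes "0 \<le> s" "s \<le> 1"
  shows "0 \<le> (pgf ^^ n) s" "(pgf ^^ n) s \<le> 1"
  using assms by (induction n) (auto simp: pgf_nonneg pgf_le_1)

lemma pgf_funpow_mono:
  assumes "0 \<le> s" "s \<le> t" "t \<le> 1"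
  shows "(pgf ^^ n) s \<le> (pgf ^^ n) t"
proof (induction n)
  case (Suc n)
  then show ?case using assms pgf_funpow_bounds by (auto intro!: pgf_mono)
qed (use assms in auto)

lemma pgf_tendsto:
  assumes "s \<longlonglongrightarrow> a" "\<And>n. 0 \<le> s n" "\<And>n. s n \<le> 1"
  shows "(\<lambda>n. pgf (s n)) \<longlonglongrightarrow> pgf a"
  unfolding pgf_def
proof (rule integral_dominated_convergence[where w = "\<lambda>_. 1"])
  show "AE x in N. (\<lambda>n. s n ^ L x) \<longlonglongrightarrow> a ^ L x"
    using assms(1) by (intro AE_I2 tendsto_intros)
  show "AE x in N. norm (s n ^ L x) \<le> 1" for n
    using assms by (auto intro: power_le_one)
qed auto

text \<open>A fixed point \<open>u < 1\<close> satisfies \<open>mean_defect (1 - u) = m - 1\<close>,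
  and \<open>mean_defect\<close> is injective on \<open>[0, 1]\<close>.\<close>

lemma pgf_fixed_point_unique:
  assumes "pgf r = r" "pgf s = s" "0 \<le> r" "r < 1" "0 \<le> s" "s < 1"
  shows "r = s"
proof -
  have *: "mean_defect (1 - u) = m - 1" if "pgf u = u" "0 \<le> u" "u < 1" for u
    using one_minus_pgf[of "1 - u"] that by simp
  have "mean_defect (1 - r) = mean_defect (1 - s)"
    using assms by (simp add: *)
  then show ?thesis
    using mean_defect_strict_mono[of "1 - r" "1 - s"] mean_defect_strict_mono[of "1 - s" "1 - r"] assms
    by (cases r s rule: linorder_cases) auto
qed

lemma pgf_funpow_0_incseq: "incseq (\<lambda>n. (pgf ^^ n) 0)"
proof (rule incseq_SucI)
  fix n
  have "(pgf ^^ n) 0 \<le> (pgf ^^ n) (pgf 0)"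
    by (intro pgf_funpow_mono pgf_nonneg pgf_le_1) auto
  then show "(pgf ^^ n) 0 \<le> (pgf ^^ Suc n) 0" by (simp add: funpow_swap1)
qed

lemma pgf_funpow_0_lim:
  defines "q \<equiv> lim (\<lambda>n. (pgf ^^ n) 0)"
  shows "pgf q = q" "0 \<le> q" "q < 1"
proof -
  obtain l where l: "(\<lambda>n. (pgf ^^ n) 0) \<longlonglongrightarrow> l"
    using incseq_convergent[OF pgf_funpow_0_incseq, of 1] pgf_funpow_bounds by force
  then have q: "(\<lambda>n. (pgf ^^ n) 0) \<longlonglongrightarrow> q"
    unfolding q_def by (simp add: limI)
  have "(\<lambda>n. pgf ((pgf ^^ n) 0)) \<longlonglongrightarrow> pgf q"
    using q by (rule pgf_tendsto) (auto intro: pgf_funpow_bounds)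
  moreover have "(\<lambda>n. pgf ((pgf ^^ n) 0)) \<longlonglongrightarrow> q"
    using LIMSEQ_Suc[OF q] by simp
  ultimately show "pgf q = q" by (rule LIMSEQ_unique)
  show "0 \<le> q" using pgf_funpow_bounds(1)[of 0] by (intro LIMSEQ_le_const[OF q]) auto
  \<comment> \<open>Near 1 the chord slope \<open>m - mean_defect t\<close> exceeds 1, so some
    \<open>t > 0\<close> has \<open>pgf (1 - t) \<le> 1 - t\<close>. The iterates started at 0
    cannot cross this barrier, which keeps their limit away from 1.\<close>
  have "eventually (\<lambda>n. mean_defect (1 / m ^ n) < m - 1) sequentially"
    using mean_defect_tendsto_0 m_gt_1 by (intro order_tendstoD) auto
  then obtain k where k: "mean_defect (1 / m ^ k) < m - 1"
    by (auto simp: eventually_sequentially)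
  define t where "t = 1 / m ^ k"
  have t: "0 < t" "t \<le> 1" using m_gt_1 by (auto simp: t_def)
  have step: "pgf (1 - t) \<le> 1 - t"
  proof -
    have "t * 1 \<le> t * (m - mean_defect t)"
      using k t by (intro mult_left_mono) (auto simp: t_def)
    then show ?thesis using one_minus_pgf[of t] t by linarith
  qed
  have "(pgf ^^ n) 0 \<le> 1 - t" for n
  proof (induction n)
    case (Suc n)
    then have "pgf ((pgf ^^ n) 0) \<le> pgf (1 - t)"
      using t by (intro pgf_mono pgf_funpow_bounds) auto
    with step show ?case by simp
  qed (use t in auto)
  then have "q \<le> 1 - t" using q by (intro LIMSEQ_le_const2[OF q]) auto
  then show "q < 1" using t by simp
qed

section \<open>The defect series and the moment \<open>E [L * log_plus L]\<close>\<close>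

lemma summable_mean_defect_if_llogl:
  assumes "(\<integral>\<^sup>+ x. ennreal (real (L x) * log_plus (real (L x))) \<partial>N) < \<infinity>"
  shows "summable (\<lambda>k. mean_defect (1 / m ^ k))"
proof -
  have t: "0 \<le> 1 / m ^ n" "1 / m ^ n \<le> 1" for n using m_gt_1 by auto
  have nn: "0 \<le> real (L x) * log_plus (real (L x))" for x by (simp add: log_plus_def)
  have int: "integrable N (\<lambda>x. real (L x) * log_plus (real (L x)))"
    using assms nn by (intro integrableI_nonneg) auto
  define B where "B = (\<integral>x. 1 / ln m * (real (L x) * log_plus (real (L x)))
      + (1 + m / (m - 1)) * real (L x) \<partial>N)"
  \<comment> \<open>Integrating \<open>sum_defect_upper\<close> bounds the partial sums uniformly in
    \<open>n\<close>.\<close>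
  have "(\<Sum>k<n. mean_defect (1 / m ^ k)) \<le> B" for n
  proof -
    have "(\<Sum>k<n. mean_defect (1 / m ^ k)) = (\<integral>x. (\<Sum>k<n. defect (L x) (1 / m ^ k)) \<partial>N)"
      unfolding mean_defect_def using t
      by (intro Bochner_Integration.integral_sum[symmetric] integrable_defect)
    also have "\<dots> \<le> B"
      unfolding B_def using t int integrable_L m_gt_1
      by (intro integral_mono sum_defect_upper Bochner_Integration.integrable_sum integrable_defect
          Bochner_Integration.integrable_add integrable_mult_right) auto
    finally show ?thesis .
  qed
  then show ?thesis
    using t by (intro summableI_nonneg_bounded[where x = B] mean_defect_nonneg) auto
qed

text \<open>The factor \<open>c\<close> is kept because the converse direction only yields
  \<open>psi u \<ge> c * u\<close>, hence summability along the scales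
  \<open>c / m ^ k\<close>.\<close>

lemma llogl_if_summable_mean_defect:
  assumes "0 < c" "c \<le> 1" "summable (\<lambda>k. mean_defect (c / m ^ k))"
  shows "(\<integral>\<^sup>+ x. ennreal (real (L x) * log_plus (real (L x))) \<partial>N) < \<infinity>"
proof -
  note t = div_power_m_bounds[OF less_imp_le[OF assms(1)] assms(2)]
  have nn: "0 \<le> 2 * ln m" "0 \<le> ln 2 - ln c"
    using m_gt_1 assms by auto
  \<comment> \<open>The \<open>n\<close> from \<open>sum_defect_lower\<close> depends on
    \<open>L x\<close>, so it is replaced by the whole series. Working in \<open>ennreal\<close>
    defers the question of its convergence until after integration.\<close>
  define S where "S x = (\<Sum>k. ennreal (defect (L x) (c / m ^ k)))" for x
  have [measurable]: "S \<in> borel_measurable N" unfolding S_def by measurable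
  have "ennreal (real (L x) * log_plus (real (L x))) \<le>
      ennreal (2 * ln m) * S x + ennreal (ln 2 - ln c) * ennreal (real (L x))" for x
  proof -
    obtain n where n: "real (L x) * log_plus (real (L x)) \<le>
        2 * ln m * (\<Sum>k<n. defect (L x) (c / m ^ k)) + (ln 2 - ln c) * real (L x)"
      using sum_defect_lower[OF m_gt_1 assms(1,2)] by blast
    have "0 \<le> (\<Sum>k<n. defect (L x) (c / m ^ k))"
      using t by (intro sum_nonneg defect_nonneg)
    then have "ennreal (real (L x) * log_plus (real (L x))) \<le>
        ennreal (2 * ln m) * ennreal (\<Sum>k<n. defect (L x) (c / m ^ k))
          + ennreal (ln 2 - ln c) * ennreal (real (L x))"
      using n nn by (simp add: ennreal_leI flip: ennreal_mult ennreal_plus)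
    also have "ennreal (\<Sum>k<n. defect (L x) (c / m ^ k)) = (\<Sum>k<n. ennreal (defect (L x) (c / m ^ k)))"
      using t by (intro sum_ennreal[symmetric] defect_nonneg)
    also have "\<dots> \<le> S x" unfolding S_def by (intro sum_le_suminf) auto
    finally show ?thesis by (simp add: mult_left_mono add_right_mono)
  qed
  then have "(\<integral>\<^sup>+ x. ennreal (real (L x) * log_plus (real (L x))) \<partial>N) \<le>
      (\<integral>\<^sup>+ x. ennreal (2 * ln m) * S x + ennreal (ln 2 - ln c) * ennreal (real (L x)) \<partial>N)"
    by (intro nn_integral_mono)
  also have "\<dots> = ennreal (2 * ln m) * (\<integral>\<^sup>+ x. S x \<partial>N) + ennreal (ln 2 - ln c) * (\<integral>\<^sup>+ x. real (L x) \<partial>N)"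
    by (simp add: nn_integral_add nn_integral_cmult)
  also have "(\<integral>\<^sup>+ x. S x \<partial>N) = (\<Sum>k. ennreal (mean_defect (c / m ^ k)))"
    unfolding S_def mean_defect_def using t
    by (subst nn_integral_suminf)
       (auto intro!: suminf_cong nn_integral_eq_integral integrable_defect defect_nonneg)
  also have "\<dots> = ennreal (\<Sum>k. mean_defect (c / m ^ k))"
    using assms t by (intro suminf_ennreal2 mean_defect_nonneg) auto
  also have "(\<integral>\<^sup>+ x. real (L x) \<partial>N) = ennreal m"
    unfolding m_eq using integrable_L by (intro nn_integral_eq_integral) auto
  also have "ennreal (2 * ln m) * ennreal (\<Sum>k. mean_defect (c / m ^ k)) +
      ennreal (ln 2 - ln c) * ennreal m < \<infinity>"
    by (simp add: ennreal_mult_less_top)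
  finally show ?thesis .
qed

end

subsection \<open>The generating function of a generation\<close>

text \<open>Generation \<open>n\<close> depends only on the rows before \<open>n\<close>. The two
  families may live on different sample spaces, so the process can be transferred to a space of
  coordinate families.\<close>

lemma galton_watson_cong:
  assumes "\<And>k i. k < n \<Longrightarrow> \<xi> k i \<omega> = \<xi>' k i \<omega>'"
  shows "galton_watson \<xi> n \<omega> = galton_watson \<xi>' n \<omega>'"
  using assms by (induction n) auto

lemma measurable_galton_watson:
  assumes "\<And>k i. k < n \<Longrightarrow> \<xi> k i \<in> measurable M (count_space UNIV)"
  shows "galton_watson \<xi> n \<in> measurable M (count_space UNIV)"
  using assms
proof (induction n)
  case 0
  then show ?case by (simp add: galton_watson.simps[abs_def])
next
  case (Suc n)
  have [measurable]: "galton_watson \<xi> n \<in> measurable M (count_space UNIV)" using Suc by simp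
  have [measurable]: "\<xi> n i \<in> measurable M (count_space UNIV)" for i using Suc by simp
  have sum: "(\<lambda>\<omega>. \<Sum>i<j. \<xi> n i \<omega>) \<in> measurable M (count_space UNIV)" for j :: nat
    by (induction j) simp_all
  have "(\<lambda>\<omega>. \<Sum>i<galton_watson \<xi> n \<omega>. \<xi> n i \<omega>) \<in> measurable M (count_space UNIV)"
    by (rule measurable_compose_countable[where f = "\<lambda>j \<omega>. \<Sum>i<j. \<xi> n i \<omega>"]) (rule sum, simp)
  then show ?case by simp
qed

text \<open>Both integrals are decomposed over the countably many values of \<open>Z\<close>. This
  allows conditioning on a generation size without conditional expectations.\<close>

lemma integral_eq_if_eq_on_level_sets:
  fixes f g :: "'a \<Rightarrow> real" and Z :: "'a \<Rightarrow> nat"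
  assumes [measurable]: "Z \<in> measurable M (count_space UNIV)"
    and f: "integrable M f" "\<And>\<omega>. 0 \<le> f \<omega>" and g: "integrable M g" "\<And>\<omega>. 0 \<le> g \<omega>"
    and eq: "\<And>j. (\<integral>\<omega>. of_bool (Z \<omega> = j) * f \<omega> \<partial>M) = (\<integral>\<omega>. of_bool (Z \<omega> = j) * g \<omega> \<partial>M)"
  shows "(\<integral>\<omega>. f \<omega> \<partial>M) = (\<integral>\<omega>. g \<omega> \<partial>M)"
proof -
  have *: "ennreal (\<integral>\<omega>. h \<omega> \<partial>M) = (\<Sum>j. ennreal (\<integral>\<omega>. of_bool (Z \<omega> = j) * h \<omega> \<partial>M))"
    if h: "integrable M h" "\<And>\<omega>. 0 \<le> h \<omega>" for h :: "'a \<Rightarrow> real"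
  proof -
    have [measurable]: "h \<in> borel_measurable M" using h by simp
    have int: "integrable M (\<lambda>\<omega>. of_bool (Z \<omega> = j) * h \<omega>)" for j
      by (rule Bochner_Integration.integrable_bound[OF h(1)]) auto
    have "ennreal (h \<omega>) = (\<Sum>j. ennreal (of_bool (Z \<omega> = j) * h \<omega>))" for \<omega>
    proof -
      have "(\<lambda>j. ennreal (of_bool (Z \<omega> = j) * h \<omega>)) = (\<lambda>j. if j = Z \<omega> then ennreal (h \<omega>) else 0)"
        by auto
      then show ?thesis
        using sums_single[of "Z \<omega>" "\<lambda>_. ennreal (h \<omega>)"] by (simp add: sums_unique)
    qed
    then have "(\<integral>\<^sup>+\<omega>. h \<omega> \<partial>M) = (\<integral>\<^sup>+\<omega>. (\<Sum>j. ennreal (of_bool (Z \<omega> = j) * h \<omega>)) \<partial>M)"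
      by simp
    also have "\<dots> = (\<Sum>j. \<integral>\<^sup>+\<omega>. ennreal (of_bool (Z \<omega> = j) * h \<omega>) \<partial>M)"
      by (intro nn_integral_suminf) measurable
    also have "\<dots> = (\<Sum>j. ennreal (\<integral>\<omega>. of_bool (Z \<omega> = j) * h \<omega> \<partial>M))"
      using h int by (intro suminf_cong nn_integral_eq_integral) auto
    finally show ?thesis using h by (subst (asm) nn_integral_eq_integral) auto
  qed
  have "ennreal (\<integral>\<omega>. f \<omega> \<partial>M) = ennreal (\<integral>\<omega>. g \<omega> \<partial>M)"
    by (simp add: * f g eq)
  then show ?thesis using f g by (subst (asm) ennreal_inj) auto
qed

locale galton_watson_process = offspring_law N L m + M: prob_space M
  for N :: "'b measure" and L :: "'b \<Rightarrow> nat" and m :: real and M :: "'a measure" +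
  fixes \<xi> :: "nat \<Rightarrow> nat \<Rightarrow> 'a \<Rightarrow> nat"
  assumes iid: "iid_copies M \<xi> N L"
begin

abbreviation Z :: "nat \<Rightarrow> 'a \<Rightarrow> nat" where
  "Z \<equiv> galton_watson \<xi>"

lemma indep_offspring: "M.indep_vars (\<lambda>_. count_space UNIV) (\<lambda>(n, i). \<xi> n i) UNIV"
  using iid by (simp add: iid_copies_def)

lemma measurable_offspring [measurable]: "\<xi> n i \<in> measurable M (count_space UNIV)"
  using indep_offspring unfolding M.indep_vars_def by (auto dest!: bspec[of UNIV _ "(n, i)"])

lemma measurable_Z [measurable]: "Z n \<in> measurable M (count_space UNIV)"
  by (rule measurable_galton_watson) simp

lemma integrable_power:
  assumes "0 \<le> s" "s \<le> 1" and [measurable]: "X \<in> measurable M (count_space UNIV)"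
  shows "integrable M (\<lambda>\<omega>. s ^ X \<omega> :: real)"
  using assms by (intro M.integrable_const_bound[where B = 1]) (auto intro: power_le_one)

lemma expectation_power_offspring: "(\<integral>\<omega>. s ^ \<xi> n i \<omega> \<partial>M) = pgf s"
proof -
  have "(\<integral>\<omega>. s ^ \<xi> n i \<omega> \<partial>M) = (\<integral>k. s ^ k \<partial>distr M (count_space UNIV) (\<xi> n i))"
    by (subst integral_distr) auto
  also have "distr M (count_space UNIV) (\<xi> n i) = distr N (count_space UNIV) L"
    using iid by (simp add: iid_copies_def)
  also have "(\<integral>k. s ^ k \<partial>distr N (count_space UNIV) L) = pgf s"
    unfolding pgf_def by (subst integral_distr) auto
  finally show ?thesis .
qed

lemma expectation_prod_power_offspring:
  assumes "0 \<le> s" "s \<le> 1"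
  shows "(\<integral>\<omega>. (\<Prod>i<j. s ^ \<xi> n i \<omega>) \<partial>M) = pgf s ^ j"
proof -
  define Y where "Y = (\<lambda>(n, i) \<omega>. s ^ \<xi> n i \<omega>)"
  have "M.indep_vars (\<lambda>_. borel) (\<lambda>p \<omega>. s ^ (case p of (n, i) \<Rightarrow> \<xi> n i) \<omega>) (Pair n ` {..<j})"
    by (rule M.indep_vars_compose2[OF M.indep_vars_subset[OF indep_offspring]]) auto
  also have "(\<lambda>p \<omega>. s ^ (case p of (n, i) \<Rightarrow> \<xi> n i) \<omega>) = Y"
    by (auto simp: Y_def fun_eq_iff)
  finally have "(\<integral>\<omega>. (\<Prod>p\<in>Pair n ` {..<j}. Y p \<omega>) \<partial>M) = (\<Prod>p\<in>Pair n ` {..<j}. \<integral>\<omega>. Y p \<omega> \<partial>M)"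
    using assms by (intro M.indep_vars_lebesgue_integral) (auto simp: Y_def intro: integrable_power)
  then show ?thesis
    by (simp add: prod.reindex inj_on_def Y_def expectation_power_offspring)
qed

text \<open>On \<open>Z n = j\<close> the next generation is a sum of \<open>j\<close> offspring
  numbers from row \<open>n\<close>, which is independent of the earlier rows; their joint power has
  expectation \<open>pgf s ^ j\<close>.\<close>

lemma expectation_power_Z_Suc:
  assumes s: "0 \<le> s" "s \<le> 1"
  shows "(\<integral>\<omega>. s ^ Z (Suc n) \<omega> \<partial>M) = (\<integral>\<omega>. pgf s ^ Z n \<omega> \<partial>M)"
proof (rule integral_eq_if_eq_on_level_sets[OF measurable_Z[of n]])
  show "integrable M (\<lambda>\<omega>. s ^ Z (Suc n) \<omega>)" "integrable M (\<lambda>\<omega>. pgf s ^ Z n \<omega>)"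
    using s by (auto intro!: integrable_power pgf_nonneg pgf_le_1 simp del: galton_watson.simps)
  fix j
  let ?C = "\<lambda>_. count_space UNIV :: nat measure"
  let ?X = "\<lambda>(n, i). \<xi> n i"
  let ?A = "{p :: nat \<times> nat. fst p < n}" and ?B = "{p :: nat \<times> nat. fst p = n}"
  let ?RA = "\<lambda>\<omega>. restrict (\<lambda>p. ?X p \<omega>) ?A" and ?RB = "\<lambda>\<omega>. restrict (\<lambda>p. ?X p \<omega>) ?B"
  \<comment> \<open>Both factors are written as functions of coordinate families \<open>w\<close>,
    so that independence of the two blocks of rows carries over by composition. In
    \<open>past\<close> the process is run on the coordinate projections.\<close>
  define past where "past w = (of_bool (galton_watson (\<lambda>k i w. w (k, i)) n w = j) :: real)"
    for w :: "nat \<times> nat \<Rightarrow> nat"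
  define present where "present w = (\<Prod>i<j. s ^ w (n, i))" for w :: "nat \<times> nat \<Rightarrow> nat"
  have ind: "M.indep_var (PiM ?A ?C) ?RA (PiM ?B ?C) ?RB"
    by (rule M.indep_var_restrict[OF indep_offspring]) auto
  have [measurable]: "galton_watson (\<lambda>k i w. w (k, i)) n \<in> measurable (PiM ?A ?C) (count_space UNIV)"
    by (rule measurable_galton_watson) (rule measurable_component_singleton, simp)
  have past_meas: "past \<in> borel_measurable (PiM ?A ?C)"
    unfolding past_def by measurable
  have present_meas: "present \<in> borel_measurable (PiM ?B ?C)"
    unfolding present_def
    by (intro borel_measurable_prod measurable_compose[OF measurable_component_singleton]) auto
  have past: "past \<circ> ?RA = (\<lambda>\<omega>. of_bool (Z n \<omega> = j))"
  proof
    fix \<omega>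
    have "galton_watson (\<lambda>k i w. w (k, i)) n (?RA \<omega>) = Z n \<omega>"
      by (rule galton_watson_cong) simp
    then show "(past \<circ> ?RA) \<omega> = of_bool (Z n \<omega> = j)" by (simp add: past_def)
  qed
  have present: "present \<circ> ?RB = (\<lambda>\<omega>. \<Prod>i<j. s ^ \<xi> n i \<omega>)"
    by (rule ext) (simp add: present_def)
  have "M.indep_var borel (past \<circ> ?RA) borel (present \<circ> ?RB)"
    by (rule M.indep_var_compose[OF ind past_meas present_meas])
  then have "M.indep_var borel (\<lambda>\<omega>. of_bool (Z n \<omega> = j)) borel (\<lambda>\<omega>. \<Prod>i<j. s ^ \<xi> n i \<omega>)"
    unfolding past present .
  then have "(\<integral>\<omega>. of_bool (Z n \<omega> = j) * (\<Prod>i<j. s ^ \<xi> n i \<omega>) \<partial>M) =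
      (\<integral>\<omega>. of_bool (Z n \<omega> = j) \<partial>M) * (\<integral>\<omega>. (\<Prod>i<j. s ^ \<xi> n i \<omega>) \<partial>M)"
    using s by (intro M.indep_var_lebesgue_integral M.integrable_const_bound[where B = 1])
      (auto simp: abs_prod intro!: prod_le_1 power_le_one)
  also have "\<dots> = (\<integral>\<omega>. of_bool (Z n \<omega> = j) * pgf s ^ j \<partial>M)"
    using s by (simp add: expectation_prod_power_offspring)
  also have "\<dots> = (\<integral>\<omega>. of_bool (Z n \<omega> = j) * pgf s ^ Z n \<omega> \<partial>M)"
    by (intro Bochner_Integration.integral_cong) auto
  also have "(\<integral>\<omega>. of_bool (Z n \<omega> = j) * (\<Prod>i<j. s ^ \<xi> n i \<omega>) \<partial>M) =
      (\<integral>\<omega>. of_bool (Z n \<omega> = j) * s ^ Z (Suc n) \<omega> \<partial>M)"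
    by (intro Bochner_Integration.integral_cong) (auto simp: power_sum)
  finally show "(\<integral>\<omega>. of_bool (Z n \<omega> = j) * s ^ Z (Suc n) \<omega> \<partial>M) =
      (\<integral>\<omega>. of_bool (Z n \<omega> = j) * pgf s ^ Z n \<omega> \<partial>M)" .
qed (simp_all add: s pgf_nonneg del: galton_watson.simps)

lemma expectation_power_Z:
  assumes "0 \<le> s" "s \<le> 1"
  shows "(\<integral>\<omega>. s ^ Z n \<omega> \<partial>M) = (pgf ^^ n) s"
  using assms
proof (induction n arbitrary: s)
  case 0
  then show ?case by (simp add: M.prob_space)
next
  case (Suc n)
  then show ?case
    by (simp add: expectation_power_Z_Suc pgf_nonneg pgf_le_1 funpow_Suc_right
        del: galton_watson.simps funpow.simps)
qed

lemma prob_Z_eq_0: "measure M {\<omega> \<in> space M. Z n \<omega> = 0} = (pgf ^^ n) 0"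
proof -
  have "measure M {\<omega> \<in> space M. Z n \<omega> = 0} = (\<integral>\<omega>. indicator {\<omega> \<in> space M. Z n \<omega> = 0} \<omega> \<partial>M)"
    by (simp add: Int_absorb2 subset_eq)
  \<comment> \<open>Since \<open>0 ^ 0 = 1\<close>, the power \<open>0 ^ Z n\<close> is the
    indicator of extinction by generation \<open>n\<close>.\<close>
  also have "\<dots> = (\<integral>\<omega>. 0 ^ Z n \<omega> \<partial>M)"
    by (intro Bochner_Integration.integral_cong) (auto simp: power_0_left)
  finally show ?thesis by (simp add: expectation_power_Z)
qed

end

subsection \<open>The Laplace transform of the limit\<close>

locale galton_watson_limit = galton_watson_process N L m M \<xi>
  for N :: "'b measure" and L :: "'b \<Rightarrow> nat" and m :: real and M :: "'a measure"
    and \<xi> :: "nat \<Rightarrow> nat \<Rightarrow> 'a \<Rightarrow> nat" +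
  fixes W :: "'a \<Rightarrow> real"
  assumes measurable_W [measurable]: "W \<in> borel_measurable M"
    and tendsto_W: "AE \<omega> in M. (\<lambda>n. real (Z n \<omega>) / m ^ n) \<longlonglongrightarrow> W \<omega>"
begin

text \<open>One minus the Laplace transform of \<open>W\<close>; the complement is used because the
  analysis takes place near \<open>u = 0\<close>, where it is small.\<close>

definition psi :: "real \<Rightarrow> real" where
  "psi u = (\<integral>\<omega>. 1 - exp (- (u * W \<omega>)) \<partial>M)"

text \<open>For \<open>u \<ge> 0\<close> this is \<open>psi\<close> with \<open>W\<close> replaced
  by \<open>Z n / m ^ n\<close>, expressed through iterates of \<open>pgf\<close>.\<close>

definition psi_approx :: "nat \<Rightarrow> real \<Rightarrow> real" where
  "psi_approx n u = 1 - (pgf ^^ n) (exp (- (u / m ^ n)))"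

lemma W_nonneg: "AE \<omega> in M. 0 \<le> W \<omega>"
  using tendsto_W
proof eventually_elim
  case (elim \<omega>)
  show ?case by (rule LIMSEQ_le_const[OF elim]) (use m_gt_1 in auto)
qed

lemma integrable_one_minus_exp:
  assumes "0 \<le> u"
  shows "integrable M (\<lambda>\<omega>. 1 - exp (- (u * W \<omega>)))"
proof (rule M.integrable_const_bound[where B = 1])
  show "AE \<omega> in M. norm (1 - exp (- (u * W \<omega>))) \<le> 1"
    using W_nonneg by eventually_elim (use assms in auto)
qed measurable

lemma psi_approx_eq:
  assumes "0 \<le> u"
  shows "psi_approx n u = (\<integral>\<omega>. 1 - exp (- (u * (real (Z n \<omega>) / m ^ n))) \<partial>M)"
proof -
  have s: "0 \<le> exp (- (u / m ^ n))" "exp (- (u / m ^ n)) \<le> 1"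
    using assms m_gt_1 by auto
  have *: "exp (- (u / m ^ n)) ^ k = exp (- (u * (real k / m ^ n)))" for k
    by (simp flip: exp_of_nat_mult)
  show ?thesis
    using integrable_power[OF s measurable_Z, of n] expectation_power_Z[OF s, of n]
    by (simp add: psi_approx_def M.prob_space *)
qed

lemma psi_approx_tendsto:
  assumes "0 \<le> u"
  shows "(\<lambda>n. psi_approx n u) \<longlonglongrightarrow> psi u"
  unfolding psi_def psi_approx_eq[OF assms]
proof (rule integral_dominated_convergence[where w = "\<lambda>_. 1"])
  show "AE \<omega> in M. (\<lambda>n. 1 - exp (- (u * (real (Z n \<omega>) / m ^ n)))) \<longlonglongrightarrow> 1 - exp (- (u * W \<omega>))"
    using tendsto_W by eventually_elim (intro tendsto_intros)
  show "AE \<omega> in M. norm (1 - exp (- (u * (real (Z n \<omega>) / m ^ n)))) \<le> 1" for n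
    using assms m_gt_1 by auto
qed auto

lemma psi_approx_bounds:
  assumes "0 \<le> u"
  shows "0 \<le> psi_approx n u" "psi_approx n u \<le> 1"
  using assms m_gt_1 pgf_funpow_bounds[of "exp (- (u / m ^ n))" n] by (auto simp: psi_approx_def)

lemma psi_bounds:
  assumes "0 \<le> u"
  shows "0 \<le> psi u" "psi u \<le> 1"
  using psi_approx_tendsto[OF assms] psi_approx_bounds[OF assms]
  by (auto intro: LIMSEQ_le_const LIMSEQ_le_const2)

text \<open>Passing from \<open>(n, u)\<close> to \<open>(n + 1, m * u)\<close> leaves the argument
  of the exponential unchanged and adds one outer application of \<open>pgf\<close>.\<close>

lemma psi_approx_Suc:
  assumes "0 \<le> u"
  shows "psi_approx (Suc n) (m * u) = 1 - pgf (1 - psi_approx n u)"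
  using m_gt_1 by (simp add: psi_approx_def)

lemma psi_mult_m:
  assumes "0 \<le> u"
  shows "psi (m * u) = 1 - pgf (1 - psi u)"
proof (rule LIMSEQ_unique)
  show "(\<lambda>n. psi_approx (Suc n) (m * u)) \<longlonglongrightarrow> psi (m * u)"
    using assms m_gt_1 by (intro LIMSEQ_Suc psi_approx_tendsto) auto
  show "(\<lambda>n. psi_approx (Suc n) (m * u)) \<longlonglongrightarrow> 1 - pgf (1 - psi u)"
    unfolding psi_approx_Suc[OF assms]
    using assms psi_approx_bounds by (intro tendsto_intros pgf_tendsto psi_approx_tendsto) auto
qed

section \<open>Bounds for \<open>psi\<close> near 0 and the mean of \<open>W\<close>\<close>

lemma psi_approx_le:
  assumes "0 \<le> u"
  shows "psi_approx n u \<le> u"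
  using assms
proof (induction n arbitrary: u)
  case 0
  then show ?case using exp_ge_add_one_self[of "- u"] by (simp add: psi_approx_def)
next
  case (Suc n)
  define v where "v = u / m"
  have v: "0 \<le> v" "u = m * v" using Suc.prems m_gt_1 by (auto simp: v_def)
  note b = psi_approx_bounds[OF v(1), of n]
  have "psi_approx (Suc n) u = psi_approx n v * (m - mean_defect (psi_approx n v))"
    using b by (simp only: v psi_approx_Suc one_minus_pgf)
  \<comment> \<open>Dropping the nonnegative defect leaves growth by a factor of at most
    \<open>m\<close> per step.\<close>
  also have "\<dots> \<le> psi_approx n v * m"
    using b mean_defect_nonneg[OF b] by (intro mult_left_mono) auto
  also have "\<dots> \<le> v * m"
    using Suc.IH[OF v(1)] m_gt_1 by (intro mult_right_mono) auto
  finally show ?case using v by (simp add: mult.commute)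
qed

lemma psi_le:
  assumes "0 \<le> u"
  shows "psi u \<le> u"
  using assms psi_approx_le by (intro LIMSEQ_le_const2[OF psi_approx_tendsto]) auto

text \<open>One step of the recursion loses \<open>p * mean_defect p\<close>, which is at most
  \<open>v * mean_defect v\<close> because \<open>p \<le> v\<close>. The loss at
  \<open>v = u / m ^ Suc k\<close> is later multiplied by \<open>m ^ k\<close>, so every scale
  enters with the same weight \<open>u / m\<close>.\<close>

lemma psi_approx_lower:
  assumes "0 \<le> u" "u \<le> 1"
  shows "m ^ n * (1 - exp (- (u / m ^ n))) - u / m * (\<Sum>k<n. mean_defect (u / m ^ Suc k))
    \<le> psi_approx n u"
  using assms
proof (induction n arbitrary: u)
  case 0
  then show ?case by (simp add: psi_approx_def)
next
  case (Suc n)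
  define v where "v = u / m"
  have v: "0 \<le> v" "u = m * v" "v \<le> 1" using Suc.prems m_gt_1 by (auto simp: v_def divide_le_eq)
  let ?p = "psi_approx n v"
  note b = psi_approx_bounds[OF v(1), of n]
  have "?p * mean_defect ?p \<le> v * mean_defect v"
    using b v psi_approx_le[OF v(1), of n]
    by (intro mult_mono mean_defect_mono mean_defect_nonneg) auto
  moreover have "m * (m ^ n * (1 - exp (- (v / m ^ n)))
      - v / m * (\<Sum>k<n. mean_defect (v / m ^ Suc k))) \<le> m * ?p"
    using Suc.IH[OF v(1,3)] m_gt_1 by (intro mult_left_mono) auto
  moreover have "psi_approx (Suc n) u = ?p * (m - mean_defect ?p)"
    using b v(1) by (simp only: v(2) psi_approx_Suc one_minus_pgf)
  moreover have "(\<Sum>k<Suc n. mean_defect (u / m ^ Suc k)) =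
      mean_defect v + (\<Sum>k<n. mean_defect (v / m ^ Suc k))"
    unfolding sum.lessThan_Suc_shift using m_gt_1 by (simp add: v_def)
  moreover have "u / m ^ Suc n = v / m ^ n" "u / m = v"
    using m_gt_1 by (simp_all add: v_def)
  ultimately show ?case using m_gt_1 by (simp add: algebra_simps)
qed

lemma psi_lower:
  assumes "0 \<le> u" "u \<le> 1" "summable (\<lambda>k. mean_defect (u / m ^ Suc k))"
  shows "u - u / m * (\<Sum>k. mean_defect (u / m ^ Suc k)) \<le> psi u"
proof (rule LIMSEQ_le)
  show "(\<lambda>n. psi_approx n u) \<longlonglongrightarrow> psi u" using assms by (intro psi_approx_tendsto)
  have "(\<lambda>n. m ^ n * (1 - exp (- (u / m ^ n)))) \<longlonglongrightarrow> u"
    using m_gt_1 by real_asymp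
  then show "(\<lambda>n. m ^ n * (1 - exp (- (u / m ^ n))) - u / m * (\<Sum>k<n. mean_defect (u / m ^ Suc k)))
      \<longlonglongrightarrow> u - u / m * (\<Sum>k. mean_defect (u / m ^ Suc k))"
    using assms(3) by (intro tendsto_intros summable_LIMSEQ)
qed (use psi_approx_lower assms in auto)

text \<open>Fatou's lemma applied to \<open>m ^ n * (1 - exp (- W / m ^ n))\<close>, which tends to
  \<open>W\<close> and has mean \<open>m ^ n * psi (1 / m ^ n) \<le> 1\<close>.\<close>

lemma nn_integral_W_le_1: "(\<integral>\<^sup>+\<omega>. ennreal (W \<omega>) \<partial>M) \<le> 1"
proof -
  define f where "f n \<omega> = ennreal (m ^ n * (1 - exp (- (1 / m ^ n * W \<omega>))))" for n \<omega>
  have [measurable]: "f n \<in> borel_measurable M" for n unfolding f_def by measurable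
  have "(\<lambda>n. m ^ n * (1 - exp (- (1 / m ^ n * w)))) \<longlonglongrightarrow> w" for w
    using m_gt_1 by real_asymp
  then have "(\<integral>\<^sup>+\<omega>. ennreal (W \<omega>) \<partial>M) = (\<integral>\<^sup>+\<omega>. liminf (\<lambda>n. f n \<omega>) \<partial>M)"
    unfolding f_def
    by (intro nn_integral_cong lim_imp_Liminf[symmetric] tendsto_ennrealI) auto
  also have "\<dots> \<le> liminf (\<lambda>n. \<integral>\<^sup>+\<omega>. f n \<omega> \<partial>M)"
    by (intro nn_integral_liminf) measurable
  also have "\<dots> \<le> 1"
  proof (rule Liminf_le)
    have "(\<integral>\<^sup>+\<omega>. f n \<omega> \<partial>M) \<le> 1" for n
    proof -
      have u: "0 \<le> 1 / m ^ n" using m_gt_1 by simp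
      have "AE \<omega> in M. 0 \<le> m ^ n * (1 - exp (- (1 / m ^ n * W \<omega>)))"
        using W_nonneg by eventually_elim (use m_gt_1 in auto)
      then have "(\<integral>\<^sup>+\<omega>. f n \<omega> \<partial>M) = ennreal (\<integral>\<omega>. m ^ n * (1 - exp (- (1 / m ^ n * W \<omega>))) \<partial>M)"
        unfolding f_def using integrable_one_minus_exp[OF u]
        by (intro nn_integral_eq_integral integrable_mult_right)
      also have "\<dots> = ennreal (m ^ n * psi (1 / m ^ n))"
        by (simp add: psi_def)
      also have "\<dots> \<le> ennreal (m ^ n * (1 / m ^ n))"
        using psi_le[OF u] m_gt_1 by (intro ennreal_leI mult_left_mono) auto
      also have "\<dots> = 1" using m_gt_1 by simp
      finally show ?thesis .
    qed
    then show "eventually (\<lambda>n. (\<integral>\<^sup>+\<omega>. f n \<omega> \<partial>M) \<le> 1) sequentially" by simp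
  qed simp
  finally show ?thesis .
qed

lemma integrable_W: "integrable M W"
  using W_nonneg nn_integral_W_le_1 by (intro integrableI_nonneg) (auto simp: less_top[symmetric] top_unique)

lemma expectation_W_le_1: "(\<integral>\<omega>. W \<omega> \<partial>M) \<le> 1"
  using nn_integral_W_le_1 nn_integral_eq_integral[OF integrable_W W_nonneg] by simp

lemma psi_le_expectation_W:
  assumes "0 \<le> u"
  shows "psi u \<le> u * (\<integral>\<omega>. W \<omega> \<partial>M)"
proof -
  have "psi u \<le> (\<integral>\<omega>. u * W \<omega> \<partial>M)"
    unfolding psi_def
  proof (rule integral_mono)
    show "1 - exp (- (u * W \<omega>)) \<le> u * W \<omega>" for \<omega>
      using exp_ge_add_one_self[of "- (u * W \<omega>)"] by simp
  qed (use assms integrable_one_minus_exp integrable_W in auto)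
  then show ?thesis by simp
qed

text \<open>At \<open>u = 1 / m ^ j\<close> the value \<open>psi u\<close> is at most
  \<open>u * E [W]\<close> and at least \<open>u\<close> times one minus a tail of the convergent
  series over \<open>m\<close>. Letting \<open>j\<close> grow removes the tail.\<close>

lemma expectation_W_eq_1_if_summable:
  assumes "summable (\<lambda>k. mean_defect (1 / m ^ k))"
  shows "(\<integral>\<omega>. W \<omega> \<partial>M) = 1"
proof (rule antisym[OF expectation_W_le_1])
  define R where "R j = (\<Sum>k. mean_defect (1 / m ^ (k + j)))" for j
  have "R \<longlonglongrightarrow> 0" unfolding R_def by (rule suminf_exist_split2[OF assms])
  then have "(\<lambda>j. 1 - 1 / m * R (Suc j)) \<longlonglongrightarrow> 1 - 1 / m * 0"
    by (intro tendsto_intros LIMSEQ_Suc)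
  moreover have "1 - 1 / m * R (Suc j) \<le> (\<integral>\<omega>. W \<omega> \<partial>M)" for j
  proof -
    define u where "u = 1 / m ^ j"
    have u: "0 < u" "u \<le> 1" using m_gt_1 by (auto simp: u_def)
    have eq: "u / m ^ Suc k = 1 / m ^ (k + Suc j)" for k
      by (simp add: u_def power_add ac_simps)
    have "summable (\<lambda>k. mean_defect (u / m ^ Suc k))"
      unfolding eq by (subst summable_iff_shift) (rule assms)
    then have "u - u / m * R (Suc j) \<le> psi u"
      using psi_lower[of u] u by (simp only: eq R_def)
    also have "\<dots> \<le> u * (\<integral>\<omega>. W \<omega> \<partial>M)" using u by (intro psi_le_expectation_W) auto
    finally have "u * (1 - 1 / m * R (Suc j)) \<le> u * (\<integral>\<omega>. W \<omega> \<partial>M)"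
      by (simp add: algebra_simps)
    then show ?thesis using u by simp
  qed
  ultimately show "1 \<le> (\<integral>\<omega>. W \<omega> \<partial>M)" by (auto intro: LIMSEQ_le_const2)
qed

section \<open>The event \<open>W = 0\<close> and the necessity of the moment condition\<close>

lemma psi_power_tendsto: "(\<lambda>n. psi (m ^ n)) \<longlonglongrightarrow> 1 - measure M {\<omega> \<in> space M. W \<omega> = 0}"
proof -
  have "(\<lambda>n. psi (m ^ n)) \<longlonglongrightarrow> (\<integral>\<omega>. 1 - indicator {\<omega> \<in> space M. W \<omega> = 0} \<omega> \<partial>M)"
    unfolding psi_def
  proof (rule integral_dominated_convergence[where w = "\<lambda>_. 1"])
    have lim: "(\<lambda>n. exp (- (m ^ n * w))) \<longlonglongrightarrow> 0" if "0 < w" for w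
      using m_gt_1 that by real_asymp
    show "AE \<omega> in M. (\<lambda>n. 1 - exp (- (m ^ n * W \<omega>))) \<longlonglongrightarrow>
        1 - indicator {\<omega> \<in> space M. W \<omega> = 0} \<omega>"
      using W_nonneg AE_space
    proof eventually_elim
      case (elim \<omega>)
      show ?case
      proof (cases "W \<omega> = 0")
        case False
        then show ?thesis
          using elim tendsto_diff[OF tendsto_const lim[of "W \<omega>"], of 1] by simp
      qed (use elim in simp)
    qed
    show "AE \<omega> in M. norm (1 - exp (- (m ^ n * W \<omega>))) \<le> 1" for n
      using W_nonneg by eventually_elim (use m_gt_1 in auto)
  qed auto
  also have "(\<integral>\<omega>. 1 - indicator {\<omega> \<in> space M. W \<omega> = 0} \<omega> \<partial>M) = 1 - measure M {\<omega> \<in> space M. W \<omega> = 0}"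
  proof -
    have "{\<omega> \<in> space M. W \<omega> = 0} \<in> sets M" by measurable
    then have "integrable M (indicat_real {\<omega> \<in> space M. W \<omega> = 0})"
      by (simp add: integrable_indicator_iff M.emeasure_finite less_top[symmetric])
    then show ?thesis by (simp add: M.prob_space Int_absorb2 subset_eq)
  qed
  finally show ?thesis .
qed

text \<open>The functional equation \<open>psi_mult_m\<close> is passed to the limit along
  \<open>u = m ^ n\<close>.\<close>

lemma pgf_prob_W_eq_0:
  defines "r \<equiv> measure M {\<omega> \<in> space M. W \<omega> = 0}"
  shows "pgf r = r"
proof -
  have "(\<lambda>n. 1 - psi (m ^ n)) \<longlonglongrightarrow> 1 - (1 - r)"
    unfolding r_def by (intro tendsto_intros psi_power_tendsto)
  then have lim: "(\<lambda>n. 1 - psi (m ^ n)) \<longlonglongrightarrow> r" by simp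
  have "(\<lambda>n. pgf (1 - psi (m ^ n))) \<longlonglongrightarrow> pgf r"
    using lim by (rule pgf_tendsto) (use psi_bounds m_gt_1 in auto)
  moreover have "pgf (1 - psi (m ^ n)) = 1 - psi (m ^ Suc n)" for n
    using m_gt_1 by (simp add: psi_mult_m)
  ultimately show ?thesis using LIMSEQ_Suc[OF lim] by (auto intro: LIMSEQ_unique)
qed

lemma llogl_if_W_nontrivial:
  assumes "measure M {\<omega> \<in> space M. W \<omega> = 0} \<noteq> 1"
  shows "(\<integral>\<^sup>+ x. ennreal (real (L x) * log_plus (real (L x))) \<partial>N) < \<infinity>"
proof -
  define c where "c = psi 1"
  have nW: "\<not> (AE \<omega> in M. W \<omega> = 0)"
    using assms M.prob_eq_1[of "{\<omega> \<in> space M. W \<omega> = 0}"] by auto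
  have "c \<noteq> 0"
  proof
    assume "c = 0"
    moreover have "AE \<omega> in M. 0 \<le> 1 - exp (- (1 * W \<omega>))"
      using W_nonneg by eventually_elim auto
    ultimately have "AE \<omega> in M. 1 - exp (- (1 * W \<omega>)) = 0"
      unfolding c_def psi_def
      by (subst (asm) integral_nonneg_eq_0_iff_AE) (use integrable_one_minus_exp[of 1] in auto)
    then have "AE \<omega> in M. W \<omega> = 0" by eventually_elim simp
    then show False using nW by simp
  qed
  then have c: "0 < c" "c \<le> 1" using psi_bounds[of 1] by (auto simp: c_def)
  define p where "p k = psi (1 / m ^ k)" for k
  \<comment> \<open>The ratio \<open>psi u / u\<close> at \<open>u = 1 / m ^ k\<close>.\<close>
  define h where "h k = m ^ k * p k" for k
  have p: "0 \<le> p k" "p k \<le> 1" "p k \<le> 1 / m ^ k" for k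
    using m_gt_1 psi_bounds psi_le by (auto simp: p_def)
  \<comment> \<open>Written as an increment, the functional equation turns the defects into
    telescoping differences of the sequence \<open>h\<close>, which is bounded by 1.\<close>
  have h_step: "h (Suc k) - h k = h (Suc k) * mean_defect (p (Suc k)) / m" for k
  proof -
    have "p k = psi (m * (1 / m ^ Suc k))" using m_gt_1 by (simp add: p_def)
    also have "\<dots> = p (Suc k) * (m - mean_defect (p (Suc k)))"
      using m_gt_1 p[of "Suc k"] one_minus_pgf[of "p (Suc k)"] unfolding p_def by (subst psi_mult_m) auto
    finally have pk: "p k = p (Suc k) * (m - mean_defect (p (Suc k)))" .
    show ?thesis unfolding h_def pk using m_gt_1 by (simp add: field_simps)
  qed
  have h_nonneg: "0 \<le> h k" for k using p m_gt_1 by (simp add: h_def)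
  have h_le: "h k \<le> 1" for k using p(3)[of k] m_gt_1 by (simp add: h_def field_simps)
  have "incseq h"
  proof (rule incseq_SucI)
    fix k
    have "0 \<le> h (Suc k) * mean_defect (p (Suc k)) / m"
      using h_nonneg mean_defect_nonneg p m_gt_1 by simp
    then show "h k \<le> h (Suc k)" using h_step[of k] by simp
  qed
  then have h_ge: "c \<le> h k" for k
    using incseqD[of h 0 k] by (simp add: h_def p_def c_def)
  \<comment> \<open>The increments involve \<open>p (Suc k) \<ge> c / m ^ Suc k\<close>, so the
    scales start at \<open>c / m\<close>.\<close>
  have c': "0 < c / m" "c / m \<le> 1" using c m_gt_1 by (auto simp: divide_le_eq)
  note t = div_power_m_bounds[OF less_imp_le[OF c'(1)] c'(2)]
  have bound: "mean_defect (c / m / m ^ k) \<le> m / c * (h (Suc k) - h k)" for k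
  proof -
    have cp: "c / m / m ^ k \<le> p (Suc k)"
      using h_ge[of "Suc k"] m_gt_1 by (simp add: h_def field_simps)
    have "c * mean_defect (c / m / m ^ k) \<le> h (Suc k) * mean_defect (p (Suc k))"
      by (intro mult_mono mean_defect_mono mean_defect_nonneg t cp p h_ge h_nonneg)
    also have "\<dots> = m * (h (Suc k) - h k)" using h_step[of k] m_gt_1 by (simp add: field_simps)
    finally show ?thesis using c by (simp add: field_simps)
  qed
  have "(\<Sum>k<n. mean_defect (c / m / m ^ k)) \<le> m / c" for n
  proof -
    have "(\<Sum>k<n. mean_defect (c / m / m ^ k)) \<le> (\<Sum>k<n. m / c * (h (Suc k) - h k))"
      by (intro sum_mono bound)
    also have "\<dots> = m / c * (h n - h 0)"
      by (simp only: sum_distrib_left[symmetric] sum_lessThan_telescope)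
    also have "\<dots> \<le> m / c * 1"
      using h_le[of n] h_nonneg[of 0] c m_gt_1 by (intro mult_left_mono) auto
    finally show ?thesis by simp
  qed
  then have "summable (\<lambda>k. mean_defect (c / m / m ^ k))"
    using t by (intro summableI_nonneg_bounded mean_defect_nonneg) auto
  then show ?thesis by (rule llogl_if_summable_mean_defect[OF c'])
qed

end

theorem theoremA:
  fixes N :: "'b measure" and L :: "'b \<Rightarrow> nat"
    and M :: "'a measure" and \<xi> :: "nat \<Rightarrow> nat \<Rightarrow> 'a \<Rightarrow> nat"
    and Z :: "nat \<Rightarrow> 'a \<Rightarrow> nat" and W :: "'a \<Rightarrow> real" and m q :: real
  assumes "prob_space N" and "L \<in> measurable N (count_space UNIV)"
    and "prob_space M" and "iid_copies M \<xi> N L"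
    and "Z = galton_watson \<xi>"
    and "integrable N (\<lambda>x. real (L x))"
    and "m = (\<integral>x. real (L x) \<partial>N)" and "1 < m"
    and "q = extinction_prob M Z"
    and "W \<in> borel_measurable M"
    and "AE \<omega> in M. (\<lambda>n. real (Z n \<omega>) / m ^ n) \<longlonglongrightarrow> W \<omega>"
  shows "(measure M {\<omega> \<in> space M. W \<omega> = 0} = q \<longleftrightarrow> (\<integral>\<omega>. W \<omega> \<partial>M) = 1) \<and>
         ((\<integral>\<omega>. W \<omega> \<partial>M) = 1 \<longleftrightarrow>
          (\<integral>\<^sup>+ x. ennreal (real (L x) * log_plus (real (L x))) \<partial>N) < \<infinity>)"
proof -
  interpret galton_watson_limit N L m M \<xi> W
    using assms
    by (intro galton_watson_limit.intro galton_watson_process.intro offspring_law.intro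
        offspring_law_axioms.intro galton_watson_process_axioms.intro galton_watson_limit_axioms.intro)
      auto
  define r where "r = measure M {\<omega> \<in> space M. W \<omega> = 0}"
  have q: "pgf q = q" "0 \<le> q" "q < 1"
    using pgf_funpow_0_lim by (simp_all add: assms(5,9) extinction_prob_def prob_Z_eq_0)
  have r: "pgf r = r" "0 \<le> r" "r \<le> 1"
    by (simp_all add: r_def pgf_prob_W_eq_0)
  \<comment> \<open>Everything hinges on whether \<open>r = 1\<close>. If so, (i) fails because
    \<open>q < 1\<close>, and (ii) fails because \<open>W\<close> vanishes almost surely. Otherwise
    (i) and (iii) hold, and (iii) always implies (ii).\<close>
  have "(\<integral>\<omega>. W \<omega> \<partial>M) \<noteq> 1" if "r = 1"
  proof -
    have "AE \<omega> in M. W \<omega> = 0"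
      using that M.prob_eq_1[of "{\<omega> \<in> space M. W \<omega> = 0}"] by (auto simp: r_def)
    then have "(\<integral>\<omega>. W \<omega> \<partial>M) = 0" by (rule integral_eq_zero_AE)
    then show ?thesis by simp
  qed
  moreover have "r = q" if "r \<noteq> 1"
    using pgf_fixed_point_unique[of r q] q r that by simp
  moreover have "(\<integral>\<^sup>+ x. ennreal (real (L x) * log_plus (real (L x))) \<partial>N) < \<infinity>" if "r \<noteq> 1"
    using llogl_if_W_nontrivial that by (simp add: r_def)
  moreover have "(\<integral>\<omega>. W \<omega> \<partial>M) = 1"
    if "(\<integral>\<^sup>+ x. ennreal (real (L x) * log_plus (real (L x))) \<partial>N) < \<infinity>"
    using that by (intro expectation_W_eq_1_if_summable summable_mean_defect_if_llogl)
  ultimately show ?thesis using q(3) unfolding r_def[symmetric] by fastforce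
qed

end
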